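(* Assume $\alpha\in[0,1)$. Then $$\lim_{n\to\infty}\frac{S_n-\mathbb{E}[S_n]}{n}=0\quad\text{almost surely},\qquad\text{and}\qquad \lim_{n\to\infty}\frac{S_n}{n}=\frac{\omega}{1-\alpha}\quad\text{almost surely}.$$
   Context: Fix $p,q,r\ge 0$ with $p+q+r=1$ and $\theta\in[0,1)$. Let $(X_n)_{n\ge1}$ be random variables with values in $\{-1,0,+1\}$ such that $\mathbb{P}(X_1=+1)=p$, $\mathbb{P}(X_1=-1)=q$, $\mathbb{P}(X_1=0)=r$. Let $\mathcal F_n=\sigma(X_1,\dots,X_n)$. For $n\ge1$ let $n_+,n_-,n_0$ denote the number of indices $i\in\{1,\dots,n\}$ with $X_i=+1$, $X_i=-1$, $X_i=0$ respectively. The conditional law of $X_{n+1}$ is $\mathbb{P}(X_{n+1}=+1\mid\mathcal F_n)=\theta\big(\tfrac{n_+}{n}p+\tfrac{n_-}{n}q\big)+(1-\theta)p$, $\mathbb{P}(X_{n+1}=-1\mid\mathcal F_n)=\theta\big(\tfrac{n_-}{n}p+\tfrac{n_+}{n}q\big)+(1-\theta)q$, $\mathbb{P}(X_{n+1}=0\mid\mathcal F_n)=\theta(p+q)\tfrac{n_0}{n}+r$. Set $S_0=0$, $S_n=\sum_{i=1}^n X_i$. Notation: $\alpha=(p-q)\theta$, $\omega=(p-q)(1-\theta)$, $\tau=(1-\theta)(p+q)$, $\gamma=(p+q)\theta$, $\phi=\frac{\tau}{1-\gamma}-\left(\frac{\omega}{1-\alpha}\right)^2$. *)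

theory Defs
  imports "HOL-Probability.Probability"
begin

definition nat_filt :: "'a measure \<Rightarrow> (nat \<Rightarrow> 'a \<Rightarrow> real) \<Rightarrow> nat \<Rightarrow> 'a measure" where
  "nat_filt M X n = sigma (space M)
     (\<Union>i\<in>{1..n}. {X i -` A \<inter> space M | A. A \<in> sets borel})"

definition cnt :: "(nat \<Rightarrow> 'a \<Rightarrow> real) \<Rightarrow> real \<Rightarrow> nat \<Rightarrow> 'a \<Rightarrow> real" where
  "cnt X v n w = real (card {i\<in>{1..n}. X i w = v})"

definition psum :: "(nat \<Rightarrow> 'a \<Rightarrow> real) \<Rightarrow> nat \<Rightarrow> 'a \<Rightarrow> real" where
  "psum X n w = (\<Sum>i=1..n. X i w)"

end

theory Submission
  imports Defs
begin

text \<open>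
  With \<open>m = \<omega> / (1 - \<alpha>)\<close> the process \<open>T n = S n - m n\<close> satisfies
  \<open>E(T (n+1) | F n) = (1 + \<alpha>/n) T n\<close> and has bounded increments. Hence
  \<open>a n = E((T n / n)\<^sup>2)\<close> satisfies
  \<open>a (n+1) \<le> a n - (1 - \<alpha>) a n / (n+1) + O(1/n\<^sup>2)\<close>, and telescoping gives
  \<open>\<Sum> a n / (n+1) < \<infinity>\<close>. So \<open>\<Sum> (T n / n)\<^sup>2 / (n+1) < \<infinity>\<close>
  almost surely, which forces \<open>T n / n \<longlonglongrightarrow> 0\<close> because this sequence has
  increments \<open>O(1/n)\<close>.
\<close>

section \<open>Summability criteria for real sequences\<close>

text \<open>
  The increments of \<open>x n ^ 3\<close> are \<open>O((x n)\<^sup>2 / n + 1 / n\<^sup>2)\<close>, so the cubes converge;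
  a nonzero limit would make the series dominate the harmonic one.
\<close>

lemma tendsto_0_if_summable_square_over_n:
  fixes x :: "nat \<Rightarrow> real"
  assumes incr: "\<And>n. \<bar>x (Suc n) - x n\<bar> \<le> L / real (Suc n)"
    and bound: "\<And>n. \<bar>x n\<bar> \<le> B"
    and sq: "summable (\<lambda>n. (x n)\<^sup>2 / real (Suc n))"
  shows "x \<longlonglongrightarrow> 0"
proof -
  have B: "0 \<le> B" using bound[of 0] by linarith
  have L: "0 \<le> L" using incr[of 0] by simp
  have inv2: "summable (\<lambda>n. 1 / (real (Suc n))\<^sup>2)"
    using inverse_power_summable[of 2, where 'a = real]
    by (subst summable_Suc_iff) (simp add: field_simps)
  have bd: "\<bar>x (Suc n) ^ 3 - x n ^ 3\<bar>
      \<le> 3 * L * ((x n)\<^sup>2 / real (Suc n)) + (3 * B * L\<^sup>2 + L ^ 3) * (1 / (real (Suc n))\<^sup>2)" for n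
  proof -
    define d N where "d = x (Suc n) - x n" and "N = real (Suc n)"
    have N: "N \<ge> 1" by (simp add: N_def)
    have d: "\<bar>d\<bar> \<le> L / N" using incr[of n] by (simp add: d_def N_def)
    \<comment> \<open>In the cube the term linear in \<open>d\<close> already carries the factor
      \<open>(x n)\<^sup>2\<close>, so \<open>sq\<close> controls it. The square of \<open>x\<close>
      would only give \<open>\<bar>x n\<bar> / N\<close> there, which \<open>sq\<close> does not
      bound directly.\<close>
    have "x (Suc n) ^ 3 - x n ^ 3 = 3 * (x n)\<^sup>2 * d + 3 * x n * d\<^sup>2 + d ^ 3"
      by (simp add: d_def power2_eq_square power3_eq_cube algebra_simps)
    then have "\<bar>x (Suc n) ^ 3 - x n ^ 3\<bar> \<le> 3 * (x n)\<^sup>2 * \<bar>d\<bar> + 3 * \<bar>x n\<bar> * \<bar>d\<bar>\<^sup>2 + \<bar>d\<bar> ^ 3"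
      using abs_triangle_ineq[of "3 * (x n)\<^sup>2 * d + 3 * x n * d\<^sup>2" "d ^ 3"]
        abs_triangle_ineq[of "3 * (x n)\<^sup>2 * d" "3 * x n * d\<^sup>2"]
      by (simp add: abs_mult power_abs)
    also have "\<dots> \<le> 3 * (x n)\<^sup>2 * (L / N) + 3 * B * (L / N)\<^sup>2 + (L / N) ^ 3"
      using d bound[of n] B
      by (intro add_mono mult_left_mono[OF d] mult_mono[OF mult_left_mono[OF bound]] power_mono) auto
    also have "(L / N) ^ 3 \<le> L ^ 3 / N\<^sup>2"
      using L N by (auto simp: power_divide intro!: divide_left_mono power_increasing)
    finally show ?thesis
      by (simp add: N_def power_divide distrib_right add_divide_distrib mult.commute mult.left_commute)
  qed
  have "summable (\<lambda>n. x (Suc n) ^ 3 - x n ^ 3)"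
  proof (rule summable_comparison_test')
    show "summable (\<lambda>n. 3 * L * ((x n)\<^sup>2 / real (Suc n))
        + (3 * B * L\<^sup>2 + L ^ 3) * (1 / (real (Suc n))\<^sup>2))"
      by (intro summable_add summable_mult sq inv2)
  qed (use bd in simp)
  then have "convergent (\<lambda>n. \<Sum>k<n. x (Suc k) ^ 3 - x k ^ 3)"
    by (simp add: summable_iff_convergent)
  then obtain l where "(\<lambda>n. x n ^ 3 - x 0 ^ 3) \<longlonglongrightarrow> l"
    by (auto simp: convergent_def sum_lessThan_telescope[of "\<lambda>n. x n ^ 3"])
  then have "(\<lambda>n. (x n ^ 3 - x 0 ^ 3) + x 0 ^ 3) \<longlonglongrightarrow> l + x 0 ^ 3"
    by (intro tendsto_intros)
  \<comment> \<open>An odd power keeps the sign: the cube root is continuous on the whole line and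
    recovers \<open>x\<close> itself.\<close>
  then have "(\<lambda>n. root 3 (x n ^ 3)) \<longlonglongrightarrow> root 3 (l + x 0 ^ 3)"
    by (intro tendsto_intros) simp
  then obtain c where c: "x \<longlonglongrightarrow> c" by (auto simp: odd_real_root_power_cancel)
  have "c = 0"
  proof (rule ccontr)
    assume "c \<noteq> 0"
    then have "c\<^sup>2 / 2 < c\<^sup>2" by simp
    moreover have "(\<lambda>n. (x n)\<^sup>2) \<longlonglongrightarrow> c\<^sup>2" using c by (intro tendsto_intros)
    ultimately have "\<forall>\<^sub>F n in sequentially. c\<^sup>2 / 2 < (x n)\<^sup>2" by (blast dest: order_tendstoD(1))
    then have "\<forall>\<^sub>F n in sequentially.
        norm (inverse (real (Suc n))) \<le> 2 / c\<^sup>2 * ((x n)\<^sup>2 / real (Suc n))"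
    proof eventually_elim
      fix n assume "c\<^sup>2 / 2 < (x n)\<^sup>2"
      then have "1 / real (Suc n) \<le> (2 / c\<^sup>2 * (x n)\<^sup>2) / real (Suc n)"
        using \<open>c \<noteq> 0\<close> by (intro divide_right_mono) (auto simp: field_simps)
      then show "norm (inverse (real (Suc n))) \<le> 2 / c\<^sup>2 * ((x n)\<^sup>2 / real (Suc n))"
        by (simp add: inverse_eq_divide)
    qed
    then have "summable (\<lambda>n. inverse (real (Suc n)))"
      by (rule summable_comparison_test_ev) (intro summable_mult sq)
    then show False
      using not_summable_harmonic[where 'a = real] summable_Suc_iff[of "\<lambda>n. inverse (real n)"]
      by simp
  qed
  with c show ?thesis by simp
qed

text \<open>Dividing by the square of the index costs a relative amount of about 2/n per step, while
  the recursion gains only 2a/n. Since a < 1, a net loss remains; the losses telescope, and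
  nonnegativity bounds their total.\<close>

lemma summable_over_cube_if_recursion:
  fixes V :: "nat \<Rightarrow> real"
  assumes V: "\<And>n. 0 \<le> V n"
    and rec: "\<And>n. n \<ge> 1 \<Longrightarrow> V (Suc n) \<le> (1 + 2 * a / real n) * V n + C"
    and a: "0 \<le> a" "a < 1"
  shows "summable (\<lambda>n. V n / (real n)\<^sup>2 / real (Suc n))"
proof -
  \<comment> \<open>The shift by one starts where \<open>rec\<close> becomes available and keeps the
    denominators positive. The omitted term at 0 does not affect summability.\<close>
  define u where "u n = V (Suc n) / (real (Suc n))\<^sup>2" for n
  have u: "0 \<le> u n" for n by (simp add: u_def V)
  \<comment> \<open>The sign of \<open>C\<close> is unknown; the absolute value makes the error
    terms nonnegative, so that their partial sums stay below the full sum.\<close>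
  have inv2: "summable (\<lambda>n. \<bar>C\<bar> / (real n + 2)\<^sup>2)"
  proof -
    have "summable (\<lambda>n. inverse ((real (n + 2))\<^sup>2))"
      using inverse_power_summable[of 2, where 'a = real] by (subst summable_iff_shift) simp
    from summable_mult[OF this, of "\<bar>C\<bar>"] show ?thesis by (simp add: field_simps)
  qed
  have step: "(1 - a) * (u n / real (Suc (Suc n))) \<le> (u n - u (Suc n)) + \<bar>C\<bar> / (real n + 2)\<^sup>2" for n
  proof -
    define N where "N = real (Suc n)"
    have N: "N \<ge> 1" by (simp add: N_def)
    have Vn: "V (Suc n) = u n * N\<^sup>2" using N by (simp add: u_def N_def)
    have "u (Suc n) = V (Suc (Suc n)) / (N + 1)\<^sup>2" by (simp add: u_def N_def add.commute)
    also have "\<dots> \<le> ((1 + 2 * a / N) * (u n * N\<^sup>2) + \<bar>C\<bar>) / (N + 1)\<^sup>2"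
      using rec[of "Suc n"] Vn by (intro divide_right_mono) (auto simp: N_def)
    also have "(1 + 2 * a / N) * (u n * N\<^sup>2) = u n * (N\<^sup>2 + 2 * a * N)"
      using N by (simp add: field_simps power2_eq_square)
    also have "\<dots> \<le> u n * ((N + 1)\<^sup>2 - (1 - a) * (N + 1))"
    proof (rule mult_left_mono[OF _ u])
      \<comment> \<open>This is exactly the right side minus the left side of the inequality to
        prove.\<close>
      have "0 \<le> (1 - a) * N + a" using a N by simp
      then show "N\<^sup>2 + 2 * a * N \<le> (N + 1)\<^sup>2 - (1 - a) * (N + 1)"
        by (simp add: power2_eq_square algebra_simps)
    qed
    also have "(u n * ((N + 1)\<^sup>2 - (1 - a) * (N + 1)) + \<bar>C\<bar>) / (N + 1)\<^sup>2
        = u n - (1 - a) * (u n / (N + 1)) + \<bar>C\<bar> / (N + 1)\<^sup>2"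
    proof -
      have "(v * (M\<^sup>2 - (1 - a) * M) + c) / M\<^sup>2 = v - (1 - a) * (v / M) + c / M\<^sup>2"
        if "M > 0" for v M c :: real
        using that by (simp add: field_simps power2_eq_square)
      then show ?thesis using N by simp
    qed
    finally show ?thesis using N by (simp add: N_def add.commute divide_right_mono)
  qed
  have "summable (\<lambda>n. (1 - a) * (u n / real (Suc (Suc n))))"
  proof (rule summableI_nonneg_bounded)
    fix n
    show "0 \<le> (1 - a) * (u n / real (Suc (Suc n)))" using a u[of n] by simp
    have "(\<Sum>k<n. (1 - a) * (u k / real (Suc (Suc k))))
        \<le> (\<Sum>k<n. (u k - u (Suc k)) + \<bar>C\<bar> / (real k + 2)\<^sup>2)"
      by (intro sum_mono step)
    also have "\<dots> = u 0 - u n + (\<Sum>k<n. \<bar>C\<bar> / (real k + 2)\<^sup>2)"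
      by (simp only: sum.distrib sum_lessThan_telescope')
    also have "\<dots> \<le> u 0 + (\<Sum>k. \<bar>C\<bar> / (real k + 2)\<^sup>2)"
      using u[of n] sum_le_suminf[OF inv2, of "{..<n}"] by simp
    finally show "(\<Sum>k<n. (1 - a) * (u k / real (Suc (Suc k)))) \<le> \<dots>" .
  qed
  then have "summable (\<lambda>n. u n / real (Suc (Suc n)))"
    using a by (subst (asm) summable_cmult_iff) auto
  then show ?thesis
    using summable_Suc_iff[of "\<lambda>n. V n / (real n)\<^sup>2 / real (Suc n)"]
    by (simp add: u_def)
qed

section \<open>Almost sure convergence from a drift identity\<close>

lemma AE_summable_if_summable_integral:
  fixes f :: "nat \<Rightarrow> 'a \<Rightarrow> real"
  assumes int: "\<And>n. integrable M (f n)" and nonneg: "\<And>n x. 0 \<le> f n x"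
    and sum: "summable (\<lambda>n. \<integral>x. f n x \<partial>M)"
  shows "AE x in M. summable (\<lambda>n. f n x)"
proof -
  note [measurable] = borel_measurable_integrable[OF int]
  have "(\<integral>\<^sup>+x. (\<Sum>n. ennreal (f n x)) \<partial>M) = (\<Sum>n. ennreal (\<integral>x. f n x \<partial>M))"
    using int nonneg by (simp add: nn_integral_suminf nn_integral_eq_integral)
  also have "\<dots> = ennreal (\<Sum>n. \<integral>x. f n x \<partial>M)"
    using sum nonneg by (intro suminf_ennreal2) auto
  finally have "AE x in M. (\<Sum>n. ennreal (f n x)) \<noteq> \<infinity>"
    by (intro nn_integral_PInf_AE) auto
  then show ?thesis
    by eventually_elim (auto intro: summable_suminf_not_top nonneg)
qed

text \<open>The hypothesis \<open>drift\<close> is the relation E(T (n+1) - T n | F n) = (a/n) T n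
  after multiplication by T n and integration, so no filtration appears. Together with bounded
  increments it yields a recursion for the second moments.\<close>

lemma (in prob_space) AE_tendsto_0_of_drift:
  fixes T :: "nat \<Rightarrow> 'a \<Rightarrow> real"
  assumes meas [measurable]: "\<And>n. T n \<in> borel_measurable M"
    and T0: "\<And>w. w \<in> space M \<Longrightarrow> T 0 w = 0"
    and incr: "\<And>n w. w \<in> space M \<Longrightarrow> \<bar>T (Suc n) w - T n w\<bar> \<le> K"
    and drift: "\<And>n. n \<ge> 1 \<Longrightarrow>
      expectation (\<lambda>w. T n w * (T (Suc n) w - T n w)) = a / real n * expectation (\<lambda>w. (T n w)\<^sup>2)"
    and a: "0 \<le> a" "a < 1"
  shows "AE w in M. (\<lambda>n. T n w / real n) \<longlonglongrightarrow> 0"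
proof -
  obtain w0 where "w0 \<in> space M" using not_empty by blast
  then have K: "0 \<le> K" using incr[of w0 0] by linarith
  have T: "\<bar>T n w\<bar> \<le> K * real n" if w: "w \<in> space M" for n w
  proof (induction n)
    case 0
    then show ?case using T0[OF w] by simp
  next
    case (Suc n)
    then show ?case using incr[OF w, of n] by (simp add: algebra_simps)
  qed
  have int_bd: "integrable M f" if "f \<in> borel_measurable M" "\<And>w. w \<in> space M \<Longrightarrow> \<bar>f w\<bar> \<le> b"
    for f :: "'a \<Rightarrow> real" and b
    using that by (intro integrable_const_bound[where B = b]) (auto intro!: AE_I2)
  have i1: "integrable M (\<lambda>w. (T n w)\<^sup>2)" for n
    using power_mono[OF T abs_ge_zero, of _ n 2]
    by (intro int_bd[of _ "(K * real n)\<^sup>2"]) auto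
  have i2: "integrable M (\<lambda>w. T n w * (T (Suc n) w - T n w))" for n
    using K by (intro int_bd[of _ "K * real n * K"])
      (auto simp: abs_mult intro!: mult_mono T incr)
  have i3: "integrable M (\<lambda>w. (T (Suc n) w - T n w)\<^sup>2)" for n
    using power_mono[OF incr abs_ge_zero, of _ n 2]
    by (intro int_bd[of _ "K\<^sup>2"]) auto
  define V where "V n = expectation (\<lambda>w. (T n w)\<^sup>2)" for n
  have rec: "V (Suc n) \<le> (1 + 2 * a / real n) * V n + K\<^sup>2" if n: "n \<ge> 1" for n
  proof -
    \<comment> \<open>Expand the square of T n plus its increment: \<open>drift\<close> evaluates
      the cross term, which produces 2a/n, and the squared increment adds at most
      \<open>K\<^sup>2\<close>.\<close>
    have "V (Suc n) = expectation (\<lambda>w. (T n w)\<^sup>2 + 2 * (T n w * (T (Suc n) w - T n w))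
        + (T (Suc n) w - T n w)\<^sup>2)"
      unfolding V_def by (intro Bochner_Integration.integral_cong)
        (simp_all add: power2_eq_square algebra_simps)
    also have "\<dots> = V n + 2 * (a / real n * V n) + expectation (\<lambda>w. (T (Suc n) w - T n w)\<^sup>2)"
      using i1 i2 i3 drift[OF n] by (simp add: V_def)
    also have "expectation (\<lambda>w. (T (Suc n) w - T n w)\<^sup>2) \<le> expectation (\<lambda>w. K\<^sup>2)"
      using power_mono[OF incr abs_ge_zero, of _ n 2] by (intro integral_mono i3) auto
    finally show ?thesis by (simp add: prob_space algebra_simps)
  qed
  have "summable (\<lambda>n. V n / (real n)\<^sup>2 / real (Suc n))"
    by (rule summable_over_cube_if_recursion[OF _ rec a]) (simp add: V_def)
  then have "summable (\<lambda>n. expectation (\<lambda>w. (T n w / real n)\<^sup>2 / real (Suc n)))"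
    by (simp add: V_def power_divide del: of_nat_Suc)
  then have "AE w in M. summable (\<lambda>n. (T n w / real n)\<^sup>2 / real (Suc n))"
    using i1 by (intro AE_summable_if_summable_integral) (auto simp: power_divide)
  then show ?thesis
  proof (rule AE_mp, intro AE_I2 impI)
    fix w assume w: "w \<in> space M" and s: "summable (\<lambda>n. (T n w / real n)\<^sup>2 / real (Suc n))"
    show "(\<lambda>n. T n w / real n) \<longlonglongrightarrow> 0"
    proof (rule tendsto_0_if_summable_square_over_n[OF _ _ s])
      fix n
      show bound: "\<bar>T n w / real n\<bar> \<le> K"
        using T[OF w, of n] K by (cases "n = 0") (auto simp: field_simps)
      \<comment> \<open>A discrete quotient rule. Both terms of the numerator are at most
        \<open>K\<close> in absolute value, hence the constant \<open>2 * K\<close>. The case n = 0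
        rests on \<open>T 0 w = 0\<close> and on division by zero giving 0.\<close>
      have "T (Suc n) w / real (Suc n) - T n w / real n
          = ((T (Suc n) w - T n w) - T n w / real n) / real (Suc n)"
        using T0[OF w] by (cases "n = 0") (auto simp: field_simps)
      then show "\<bar>T (Suc n) w / real (Suc n) - T n w / real n\<bar> \<le> 2 * K / real (Suc n)"
        using incr[OF w, of n] bound
          abs_triangle_ineq4[of "T (Suc n) w - T n w" "T n w / real n"]
        by (auto intro!: divide_right_mono)
    qed
  qed
qed

section \<open>The natural filtration and the counts\<close>

lemma subalgebra_nat_filt:
  assumes "\<And>i. X i \<in> borel_measurable M"
  shows "subalgebra M (nat_filt M X n)"
proof -
  have gen: "(\<Union>i\<in>{1..n}. {X i -` A \<inter> space M | A. A \<in> sets borel}) \<subseteq> sets M"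
    using measurable_sets[OF assms] by blast
  have "sets (nat_filt M X n) \<subseteq> sets M"
    unfolding nat_filt_def sets_measure_of[OF order_trans[OF gen sets.space_closed]]
    by (rule sets.sigma_sets_subset[OF gen])
  then show ?thesis
    by (simp add: subalgebra_def nat_filt_def space_measure_of_conv)
qed

lemma measurable_nat_filt:
  assumes "i \<in> {1..n}"
  shows "X i \<in> borel_measurable (nat_filt M X n)"
proof (rule measurableI)
  fix A :: "real set" assume "A \<in> sets borel"
  with assms have "X i -` A \<inter> space M \<in> sets (nat_filt M X n)"
    unfolding nat_filt_def by (intro in_measure_of) blast+
  then show "X i -` A \<inter> space (nat_filt M X n) \<in> sets (nat_filt M X n)"
    by (simp add: nat_filt_def space_measure_of_conv)
qed simp

lemma cnt_eq_sum: "cnt X v n w = (\<Sum>i=1..n. if X i w = v then 1 else 0)"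
  unfolding cnt_def by (simp flip: sum.inter_filter)

text \<open>Turns the counts in the conditional laws into the walk: on {-1, 0, 1} the identity map
  is the indicator of 1 minus the indicator of -1.\<close>

lemma cnt_diff_eq_psum:
  assumes "\<And>i. i \<ge> 1 \<Longrightarrow> X i w \<in> {-1, 0, 1}"
  shows "cnt X 1 n w - cnt X (-1) n w = psum X n w"
  unfolding cnt_eq_sum psum_def sum_subtractf[symmetric]
proof (rule sum.cong[OF refl])
  fix i assume "i \<in> {1..n}"
  then show "(if X i w = 1 then 1 else 0) - (if X i w = -1 then 1 else 0) = X i w"
    using assms[of i] by auto
qed

section \<open>Law of large numbers for the walk\<close>

theorem theorem1:
  fixes M :: "'a measure" and X :: "nat \<Rightarrow> 'a \<Rightarrow> real"
    and p q r \<theta> :: real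
  assumes "prob_space M"
    and "p \<ge> 0" "q \<ge> 0" "r \<ge> 0" "p + q + r = 1"
    and "0 \<le> \<theta>" "\<theta> < 1"
    and meas: "\<And>i. X i \<in> borel_measurable M"
    and vals: "\<And>i w. i \<ge> 1 \<Longrightarrow> w \<in> space M \<Longrightarrow> X i w \<in> {-1, 0, 1}"
    and init: "measure M {w\<in>space M. X 1 w = 1} = p"
              "measure M {w\<in>space M. X 1 w = -1} = q"
              "measure M {w\<in>space M. X 1 w = 0} = r"
    and cond_plus: "\<And>n. n \<ge> 1 \<Longrightarrow> AE w in M.
        real_cond_exp M (nat_filt M X n) (\<lambda>v. if X (Suc n) v = 1 then 1 else 0) w
        = \<theta> * (cnt X 1 n w / real n * p + cnt X (-1) n w / real n * q) + (1 - \<theta>) * p"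
    and cond_minus: "\<And>n. n \<ge> 1 \<Longrightarrow> AE w in M.
        real_cond_exp M (nat_filt M X n) (\<lambda>v. if X (Suc n) v = -1 then 1 else 0) w
        = \<theta> * (cnt X (-1) n w / real n * p + cnt X 1 n w / real n * q) + (1 - \<theta>) * q"
    and cond_zero: "\<And>n. n \<ge> 1 \<Longrightarrow> AE w in M.
        real_cond_exp M (nat_filt M X n) (\<lambda>v. if X (Suc n) v = 0 then 1 else 0) w
        = \<theta> * (p + q) * (cnt X 0 n w / real n) + r"
    and alpha: "0 \<le> (p - q) * \<theta>" "(p - q) * \<theta> < 1"
  shows "(AE w in M. (\<lambda>n. (psum X n w - prob_space.expectation M (psum X n)) / real n)
            \<longlonglongrightarrow> 0)
       \<and> (AE w in M. (\<lambda>n. psum X n w / real n)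
            \<longlonglongrightarrow> ((p - q) * (1 - \<theta>)) / (1 - (p - q) * \<theta>))"
proof -
  interpret prob_space M by fact
  note [measurable] = meas
  define a m where "a = (p - q) * \<theta>" and "m = (p - q) * (1 - \<theta>) / (1 - (p - q) * \<theta>)"
  \<comment> \<open>\<open>m\<close> is the fixed point of the map sending a mean step c to \<alpha>
    c + \<omega>. This makes the constant part of the drift vanish after centring.\<close>
  have m: "a * m + (p - q) * (1 - \<theta>) = m"
    using alpha(2) by (simp add: a_def m_def field_simps)
  \<comment> \<open>The centring is by the explicit line m n instead of the expectation of the walk;
    the expectation is treated at the end.\<close>
  define T where "T n w = psum X n w - m * real n" for n w
  have [measurable]: "psum X n \<in> borel_measurable M" for n
    unfolding psum_def[abs_def] by measurable
  have [measurable]: "T n \<in> borel_measurable M" for n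
    unfolding T_def[abs_def] by measurable
  have X_bd: "\<bar>X (Suc n) w\<bar> \<le> 1" if "w \<in> space M" for n w
    using vals[of "Suc n" w] that by auto
  have psum_bd: "\<bar>psum X n w\<bar> \<le> real n" if "w \<in> space M" for n w
  proof (induction n)
    case (Suc n)
    then show ?case using X_bd[OF that, of n] by (simp add: psum_def)
  qed (simp add: psum_def)
  have T_Suc: "T (Suc n) w - T n w = X (Suc n) w - m" for n w
    by (simp add: T_def psum_def algebra_simps)
  have T_bd: "\<bar>T n w\<bar> \<le> (1 + \<bar>m\<bar>) * real n" if "w \<in> space M" for n w
    using psum_bd[OF that, of n] abs_triangle_ineq4[of "psum X n w" "m * real n"]
    by (simp add: T_def abs_mult algebra_simps)
  have int_bd: "integrable M f" if "f \<in> borel_measurable M" "\<And>w. w \<in> space M \<Longrightarrow> \<bar>f w\<bar> \<le> b"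
    for f :: "'a \<Rightarrow> real" and b
    using that by (intro integrable_const_bound[where B = b]) (auto intro!: AE_I2)
  have drift: "expectation (\<lambda>w. T n w * (T (Suc n) w - T n w))
      = a / real n * expectation (\<lambda>w. (T n w)\<^sup>2)" if n: "n \<ge> 1" for n
  proof -
    define F where "F = nat_filt M X n"
    interpret F: finite_measure_subalgebra M F
      unfolding F_def by unfold_locales (rule subalgebra_nat_filt[OF meas])
    have TF [measurable]: "T n \<in> borel_measurable F"
      unfolding T_def[abs_def] psum_def F_def
      by (intro borel_measurable_diff borel_measurable_sum measurable_nat_filt) auto
    define I :: "real \<Rightarrow> 'a \<Rightarrow> real" where "I v w = (if X (Suc n) w = v then 1 else 0)" for v w
    have I [measurable]: "I v \<in> borel_measurable M" for v
      unfolding I_def[abs_def] by measurable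
    have iI: "integrable M (\<lambda>w. T n w * I v w)" for v
    proof (rule int_bd)
      fix w assume "w \<in> space M"
      from T_bd[OF this, of n] show "\<bar>T n w * I v w\<bar> \<le> (1 + \<bar>m\<bar>) * real n"
        by (auto simp: I_def)
    qed measurable
    have iT: "integrable M (T n)" by (rule int_bd[OF _ T_bd]) measurable
    have iT2: "integrable M (\<lambda>w. (T n w)\<^sup>2)"
      using power_mono[OF T_bd abs_ge_zero, of _ n 2]
      by (intro int_bd[of _ "((1 + \<bar>m\<bar>) * real n)\<^sup>2"]) auto
    \<comment> \<open>Since T n is measurable with respect to \<open>F\<close>, each indicator
      \<open>I v\<close> may be replaced by its conditional expectation under the integral against T
      n.\<close>
    note ce = F.real_cond_exp_intg[OF iI TF I]
    have "expectation (\<lambda>w. T n w * X (Suc n) w)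
        = expectation (\<lambda>w. T n w * I 1 w - T n w * I (-1) w)"
    proof (rule Bochner_Integration.integral_cong[OF refl])
      fix w assume "w \<in> space M"
      from vals[OF _ this, of "Suc n"]
      show "T n w * X (Suc n) w = T n w * I 1 w - T n w * I (-1) w"
        by (auto simp: I_def)
    qed
    also have "\<dots> = expectation (\<lambda>w. T n w * real_cond_exp M F (I 1) w
        - T n w * real_cond_exp M F (I (-1)) w)"
      using iI ce by simp
    also have "\<dots> = expectation (\<lambda>w. a / real n * (T n w)\<^sup>2 + m * T n w)"
    proof (rule integral_cong_AE)
      show "AE w in M. T n w * real_cond_exp M F (I 1) w - T n w * real_cond_exp M F (I (-1)) w
          = a / real n * (T n w)\<^sup>2 + m * T n w"
        using cond_plus[OF n] cond_minus[OF n] AE_space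
      proof eventually_elim
        fix w
        assume ce1: "real_cond_exp M (nat_filt M X n) (\<lambda>v. if X (Suc n) v = 1 then 1 else 0) w
            = \<theta> * (cnt X 1 n w / real n * p + cnt X (-1) n w / real n * q) + (1 - \<theta>) * p"
          and ce2: "real_cond_exp M (nat_filt M X n) (\<lambda>v. if X (Suc n) v = -1 then 1 else 0) w
            = \<theta> * (cnt X (-1) n w / real n * p + cnt X 1 n w / real n * q) + (1 - \<theta>) * q"
          and w: "w \<in> space M"
        \<comment> \<open>On subtracting the two laws, the terms in p and q combine to \<theta> (p -
          q) times the difference of the counts, that is, \<alpha> times the walk.\<close>
        have "real_cond_exp M F (I 1) w - real_cond_exp M F (I (-1)) w
            = a * ((cnt X 1 n w - cnt X (-1) n w) / real n) + (p - q) * (1 - \<theta>)"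
          unfolding F_def I_def[abs_def] ce1 ce2 using n by (simp add: a_def field_simps)
        also have "\<dots> = a * (psum X n w / real n) + (p - q) * (1 - \<theta>)"
          using cnt_diff_eq_psum[of X w n] vals w by simp
        also have "\<dots> = a / real n * T n w + m"
        proof -
          have "a / real n * T n w = a * (psum X n w / real n) - a * m"
            using n by (simp add: T_def field_simps)
          then show ?thesis using m by linarith
        qed
        finally have "T n w * (real_cond_exp M F (I 1) w - real_cond_exp M F (I (-1)) w)
            = T n w * (a / real n * T n w + m)" by simp
        then show "T n w * real_cond_exp M F (I 1) w - T n w * real_cond_exp M F (I (-1)) w
            = a / real n * (T n w)\<^sup>2 + m * T n w"
          by (simp add: algebra_simps power2_eq_square)
      qed
    qed measurable
    also have "\<dots> = a / real n * expectation (\<lambda>w. (T n w)\<^sup>2) + m * expectation (T n)"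
      using iT iT2 by simp
    finally have *: "expectation (\<lambda>w. T n w * X (Suc n) w)
        = a / real n * expectation (\<lambda>w. (T n w)\<^sup>2) + m * expectation (T n)" .
    have iX: "integrable M (\<lambda>w. T n w * X (Suc n) w)"
      by (rule int_bd[of _ "(1 + \<bar>m\<bar>) * real n * 1"])
        (auto simp del: mult_1_right simp add: abs_mult intro!: mult_mono T_bd X_bd)
    \<comment> \<open>The increment is \<open>X (Suc n) w - m\<close>, so the summand m E(T n) in
      \<open>*\<close> cancels, whatever the mean of T n is.\<close>
    show ?thesis using * iX iT by (simp add: T_Suc right_diff_distrib mult.commute[of _ m])
  qed
  have "AE w in M. (\<lambda>n. T n w / real n) \<longlonglongrightarrow> 0"
  proof (rule AE_tendsto_0_of_drift[OF _ _ _ drift])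
    fix n w assume w: "w \<in> space M"
    show "T 0 w = 0" by (simp add: T_def psum_def)
    show "\<bar>T (Suc n) w - T n w\<bar> \<le> 1 + \<bar>m\<bar>" using X_bd[OF w, of n] unfolding T_Suc by linarith
  qed (use alpha in \<open>auto simp: a_def\<close>)
  then have lim: "AE w in M. (\<lambda>n. psum X n w / real n) \<longlonglongrightarrow> m"
  proof eventually_elim
    fix w assume "(\<lambda>n. T n w / real n) \<longlonglongrightarrow> 0"
    then have "(\<lambda>n. T n w / real n + m) \<longlonglongrightarrow> 0 + m" by (intro tendsto_intros)
    \<comment> \<open>Only eventually: at n = 0 both quotients are 0, and the equation would read m
      = 0.\<close>
    moreover have "\<forall>\<^sub>F n in sequentially. T n w / real n + m = psum X n w / real n"
      using eventually_gt_at_top[of 0] by eventually_elim (simp add: T_def field_simps)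
    ultimately show "(\<lambda>n. psum X n w / real n) \<longlonglongrightarrow> m"
      using tendsto_cong by fastforce
  qed
  \<comment> \<open>The claim about the centred walk follows from the one about S n / n: as |S n| is
    at most n, dominated convergence with bound 1 gives the same limit m for the expectations, and
    the two limits are subtracted.\<close>
  have "(\<lambda>n. expectation (\<lambda>w. psum X n w / real n)) \<longlonglongrightarrow> expectation (\<lambda>w. m)"
  proof (rule integral_dominated_convergence[where w = "\<lambda>_. 1"])
    fix n
    have "\<bar>psum X n w / real n\<bar> \<le> 1" if "w \<in> space M" for w
      using psum_bd[OF that, of n] by (cases "n = 0") (auto simp: field_simps)
    then show "AE w in M. norm (psum X n w / real n) \<le> 1" by (intro AE_I2) simp
  qed (use lim in auto)
  then have Elim: "(\<lambda>n. expectation (psum X n) / real n) \<longlonglongrightarrow> m"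
    by (simp add: prob_space)
  have "AE w in M. (\<lambda>n. (psum X n w - expectation (psum X n)) / real n) \<longlonglongrightarrow> 0"
    using lim
  proof eventually_elim
    fix w assume "(\<lambda>n. psum X n w / real n) \<longlonglongrightarrow> m"
    from tendsto_diff[OF this Elim]
    show "(\<lambda>n. (psum X n w - expectation (psum X n)) / real n) \<longlonglongrightarrow> 0"
      by (simp add: diff_divide_distrib)
  qed
  with lim show ?thesis by (simp add: m_def)
qed

end
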